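(* Let $n$ be a positive integer and let $\Omega_1,\Omega_2$ be two distinct copies of $2^{[n]}$, where $[n]=\{1,\dots,n\}$. For $i=1,2$ let $\bm{p}_i=(p_i^{(1)},\dots,p_i^{(n)})$ be a probability vector (i.e. $0<p_i^{(\ell)}<1$ for all $\ell$), write $p_i:=p_i^{(1)}$, and let $\mu_i$ be the product measure on $\Omega_i$ given by $$\mu_i(U)=\sum_{x\in U}\prod_{\ell\in x}p_i^{(\ell)}\prod_{k\in[n]\setminus x}(1-p_i^{(k)})\qquad (U\subset\Omega_i).$$ Assume that $p_i=\max\{p_i^{(\ell)}:\ell\in[n]\}$ for $i=1,2$, and that $p_1^{(\ell)},p_2^{(\ell)}\leqslant 1/2$ for all $\ell\geqslant 2$. If $U_1\subset\Omega_1$ and $U_2\subset\Omega_2$ are cross-intersecting (i.e. $x\cap y\neq\emptyset$ for all $x\in U_1$, $y\in U_2$), then $$\mu_1(U_1)\mu_2(U_2)\leqslant p_1p_2.$$ Moreover, let $w:=\{\ell\in[n]:(p_1^{(\ell)},p_2^{(\ell)})=(p_1,p_2)\}$ and, for $i=1,2$ and $\ell\in[n]$, let $U_i^{(\ell)}:=\{x\in\Omega_i:\ell\in x\}$. Unless $p_1=p_2=1/2$ and $|w|\geqslant 3$, equality holds if and only if $U_1=U_1^{(\ell)}$ and $U_2=U_2^{(\ell)}$ for some $\ell\in w$.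
   Context: A probability vector is a vector $\bm{p}=(p^{(1)},\dots,p^{(n)})$ with $0<p^{(\ell)}<1$ for every $\ell$. *)

theory Defs
  imports Complex_Main
begin

definition prob_vector :: "nat \<Rightarrow> (nat \<Rightarrow> real) \<Rightarrow> bool" where
  "prob_vector n p \<longleftrightarrow> (\<forall>l\<in>{1..n}. 0 < p l \<and> p l < 1)"

definition prod_weight :: "nat \<Rightarrow> (nat \<Rightarrow> real) \<Rightarrow> nat set \<Rightarrow> real" where
  "prod_weight n p x = (\<Prod>l\<in>x. p l) * (\<Prod>k\<in>{1..n} - x. 1 - p k)"

definition prod_measure :: "nat \<Rightarrow> (nat \<Rightarrow> real) \<Rightarrow> nat set set \<Rightarrow> real" where
  "prod_measure n p U = (\<Sum>x\<in>U. prod_weight n p x)"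

definition cross_intersecting :: "nat set set \<Rightarrow> nat set set \<Rightarrow> bool" where
  "cross_intersecting U V \<longleftrightarrow> (\<forall>x\<in>U. \<forall>y\<in>V. x \<inter> y \<noteq> {})"

definition dictator :: "nat \<Rightarrow> nat \<Rightarrow> nat set set" where
  "dictator n l = {x \<in> Pow {1..n}. l \<in> x}"

end

theory Submission
  imports Defs
begin

text \<open>
  Suppose first that all probabilities are at most 1/2 and write \<open>P, Q\<close> for the two maxima.
  By induction on the coordinates, the measures \<open>a, b\<close> of a cross-intersecting pair satisfy two
  inequalities: the Hoffman type bound \<open>(1-P)(1-Q) a b \<le> P Q (1-a)(1-b)\<close> and \<open>a b \<le> P Q\<close>.
  Splitting at a coordinate \<open>j\<close>, let \<open>U\<^sub>0\<close> be the section of \<open>U\<close> without \<open>j\<close> and \<open>U\<^sub>1\<close> the union of both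
  sections, and likewise for \<open>V\<close>. Then \<open>(U\<^sub>0, V\<^sub>1)\<close> and \<open>(U\<^sub>1, V\<^sub>0)\<close> are cross-intersecting, and the
  region cut out by the two inequalities is stable under
  \<open>(a\<^sub>0, b\<^sub>0), (a\<^sub>1, b\<^sub>1) \<mapsto> ((1-P) a\<^sub>0 + P a\<^sub>1, (1-Q) b\<^sub>1 + Q b\<^sub>0)\<close>.
  Unless \<open>P = Q = 1/2\<close>, equality in a step forces the two sections to agree or the family to be
  the dictatorship of \<open>j\<close>. If \<open>P = Q = 1/2\<close>, the Hoffman bound reads \<open>a + b \<le> 1\<close>, and its equality cases
  can be traced as long as few coordinates have both probabilities 1/2.
  Finally, a probability above 1/2 at the first coordinate can be lowered to 1/2, because the measure of a family
  divided by the probability of a coordinate does not increase with that probability.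
\<close>

subsection \<open>Inequalities for the induction step\<close>

lemma hoffman_step:
  fixes P Q a0 a1 b0 b1 :: real
  assumes P: "0 < P" "P \<le> 1/2" and Q: "0 < Q" "Q \<le> 1/2"
    and a: "0 \<le> a0" "a0 \<le> a1" "a1 \<le> 1" and b: "0 \<le> b1" "b1 \<le> b0" "b0 \<le> 1"
    and h0: "(1-P)*(1-Q)*(a0*b0) \<le> P*Q*((1-a0)*(1-b0))"
    and h1: "(1-P)*(1-Q)*(a1*b1) \<le> P*Q*((1-a1)*(1-b1))"
  defines "a \<equiv> (1-P)*a0 + P*a1" and "b \<equiv> (1-Q)*b1 + Q*b0"
  shows "(1-P)*(1-Q)*(a*b) \<le> P*Q*((1-a)*(1-b))"
proof -
  define C c where "C = (1-P)*(1-Q)" and "c = P*Q"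
  define D where "D = (\<lambda>x. C*x + c*(1-x))"
  have c: "0 < c" using P Q by (simp add: c_def)
  have "C - c = 1 - P - Q" by (simp add: C_def c_def algebra_simps)
  then have cC: "c \<le> C" using P Q by linarith
  have Dge: "c \<le> D x" "D x \<le> C" if "0 \<le> x" "x \<le> 1" for x
  proof -
    have "0 \<le> (C-c)*x" "0 \<le> (C-c)*(1-x)" using cC that by auto
    then show "c \<le> D x" "D x \<le> C" unfolding D_def by (auto simp: algebra_simps)
  qed
  have D0: "c \<le> D a0" and D1: "c \<le> D a1" "D a1 \<le> C" using Dge a by auto
  have h0': "b0 * D a0 \<le> c*(1-a0)" and h1': "b1 * D a1 \<le> c*(1-a1)"
    using h0 h1 by (simp_all add: D_def C_def c_def algebra_simps)
  have Da: "D a = (1-P)*D a0 + P*D a1" by (simp add: D_def a_def algebra_simps)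
  have Dapos: "0 < D a" unfolding Da using P D0 D1 c by (intro add_pos_pos mult_pos_pos) auto
  have "C*D a0 - c*D a1 \<ge> 0"
    using mult_left_mono[OF D0, of C] mult_left_mono[OF D1(2), of c] c cC mult.commute[of C c]
    by linarith
  then have "0 \<le> C*((a1-a0)*(C*D a0 - c*D a1))" using c cC a by auto
  also have "\<dots> = (1-a)*(D a0*D a1) - (Q*(1-a0)*D a1 + (1-Q)*(1-a1)*D a0)*D a"
  proof -
    have "C*(a1-a0) = (1-a0)*D a1 - (1-a1)*D a0" unfolding D_def by algebra
    moreover have "(C*x - c*y)*((1-a0)*y - (1-a1)*x)
      = (1-a)*(x*y) - (Q*(1-a0)*y + (1-Q)*(1-a1)*x)*((1-P)*x + P*y)" for x y
      unfolding a_def C_def c_def by (simp add: algebra_simps)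
    ultimately show ?thesis unfolding Da by (metis mult.assoc mult.commute)
  qed
  finally have key: "(Q*(1-a0)*D a1 + (1-Q)*(1-a1)*D a0)*D a \<le> (1-a)*(D a0*D a1)" by simp
  have "b*(D a0*D a1) = Q*(b0*D a0)*D a1 + (1-Q)*(b1*D a1)*D a0"
    by (simp add: b_def algebra_simps)
  also have "\<dots> \<le> Q*(c*(1-a0))*D a1 + (1-Q)*(c*(1-a1))*D a0"
    using h0' h1' Q D0 D1 c by (intro add_mono mult_right_mono mult_left_mono) auto
  also have "\<dots> = c*(Q*(1-a0)*D a1 + (1-Q)*(1-a1)*D a0)" by (simp add: algebra_simps)
  finally have "b*(D a0*D a1)*D a \<le> c*(Q*(1-a0)*D a1 + (1-Q)*(1-a1)*D a0)*D a"
    by (rule mult_right_mono) (use Dapos in simp)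
  then have "b*D a*(D a0*D a1) \<le> c*(Q*(1-a0)*D a1 + (1-Q)*(1-a1)*D a0)*D a"
    by (simp only: mult.assoc mult.commute[of "D a"])
  also have "\<dots> \<le> c*((1-a)*(D a0*D a1))" using key c by (simp add: mult.assoc)
  finally have "b*D a*(D a0*D a1) \<le> c*(1-a)*(D a0*D a1)" by (simp add: mult.assoc)
  then have "b*D a \<le> c*(1-a)"
    by (rule mult_right_le_imp_le) (use D0 D1 c in auto)
  then show ?thesis by (simp add: D_def C_def c_def algebra_simps)
qed

lemma extremal_form_le:
  fixes k x y A B :: real
  assumes k: "1 \<le> k" and x: "0 \<le> x" "x \<le> 1" and y: "0 \<le> y" "y \<le> 1"
    and A: "0 \<le> A" "A \<le> 1" and B: "0 \<le> B" "B \<le> 1"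
    and h0: "k*(x*B) \<le> (1-x)*(1-B)" and h1: "k*(A*y) \<le> (1-A)*(1-y)"
    and kx: "k*x \<le> A"
  shows "(k*x+A)*(y+B) \<le> 1"
    and "1 < k \<Longrightarrow> (k*x+A)*(y+B) = 1 \<Longrightarrow> x = 0 \<and> y = 0 \<and> A = 1 \<and> B = 1"
proof -
  define m where "m = k - 1"
  have k_eq: "k = 1 + m" and m: "0 \<le> m" using k by (auto simp: m_def)
  have hA: "A*(1+m*y) \<le> 1-y" and hB: "B*(1+m*x) \<le> 1-x"
    using h0 h1 by (simp_all add: m_def algebra_simps)
  have pos: "0 < 1+m*y" "0 < 1+m*x" using m x y by (auto intro!: add_pos_nonneg)
  have con: "k*x*(1+m*y) \<le> 1-y"
    using mult_right_mono[OF kx, of "1+m*y"] hA pos by linarith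
  define R where "R = 1 + m*y - k*x*y"
  have "k*x \<le> 1" using kx A by simp
  then have "k*x*y \<le> y" using mult_right_mono[of "k*x" 1 y] y by simp
  moreover have "x = 0" if "y = 1"
  proof -
    have "k*x*(1+m*y) \<le> 0" using con that by simp
    then show ?thesis using k x pos by (simp add: mult_le_0_iff)
  qed
  moreover have "0 \<le> m*y" using m y by simp
  ultimately have R: "0 < R" using y unfolding R_def by fastforce
  define T where "T = (1+m)*(x-y)^2 + m^2*(x*y)*R"
  have T: "0 \<le> T" using R m x y by (auto simp: T_def)
  have "(k*x+A)*(y+B)*((1+m*x)*(1+m*y)) = (k*x*(1+m*y) + A*(1+m*y))*(y*(1+m*x)+B*(1+m*x))"
    by algebra
  also have "\<dots> \<le> (k*x*(1+m*y) + (1-y))*(y*(1+m*x)+(1-x))"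
    using hA hB pos x y k A B m by (intro mult_mono add_mono order.refl add_nonneg_nonneg mult_nonneg_nonneg) auto
  also have "\<dots> = (1+m*x)*(1+m*y) - T - m*y*(1-y-k*x*(1+m*y))"
    unfolding T_def R_def k_eq by (simp add: algebra_simps power2_eq_square)
  also have "\<dots> \<le> (1+m*x)*(1+m*y) - T"
    using con m y by auto
  finally have main: "(k*x+A)*(y+B)*((1+m*x)*(1+m*y)) \<le> (1+m*x)*(1+m*y) - T" .
  have pp: "0 < (1+m*x)*(1+m*y)" using pos by auto
  show "(k*x+A)*(y+B) \<le> 1" using main T pp
    mult_strict_right_mono[of 1 "(k*x+A)*(y+B)" "(1+m*x)*(1+m*y)"] by linarith
  show "x = 0 \<and> y = 0 \<and> A = 1 \<and> B = 1" if "1 < k" "(k*x+A)*(y+B) = 1"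
  proof -
    have "T \<le> 0" using main that by simp
    moreover have "0 \<le> (1+m)*(x-y)^2" "0 \<le> m^2*(x*y)*R" using R m x y by auto
    ultimately have "(1+m)*(x-y)^2 = 0" "m^2*(x*y)*R = 0" unfolding T_def by linarith+
    then have "x = 0" "y = 0" using R m that by (auto simp: m_def)
    moreover from this have "A*B = 1" using that(2) by simp
    then have "A = 1 \<and> B = 1" using A B mult_right_le_one_le[of A B] mult_left_le_one_le[of B A] by auto
    ultimately show ?thesis by simp
  qed
qed

lemma product_step_near:
  fixes P Q a0 a1 b0 b1 :: real
  assumes P: "0 < P" "P \<le> 1/2" and Q: "0 < Q" "Q \<le> 1/2"
    and a: "0 \<le> a0" "a0 \<le> a1"
    and m: "a0*b0 \<le> P*Q" "a1*b1 \<le> P*Q" and near: "P*Q*a1 < (1-P)*(1-Q)*a0"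
  defines "F \<equiv> ((1-P)*a0 + P*a1)*((1-Q)*b1 + Q*b0)"
  shows "F \<le> P*Q" and "F = P*Q \<Longrightarrow> a0 = a1"
proof -
  have PQ: "0 < P*Q" "0 < (1-P)*(1-Q)" using P Q by auto
  have a0: "0 < a0" using near a mult_nonneg_nonneg[OF less_imp_le[OF PQ(1)], of a1] by (cases "a0 = 0") auto
  then have a1: "0 < a1" using a by simp
  have "F*(a0*a1) = ((1-P)*a0 + P*a1)*((1-Q)*a0*(a1*b1) + Q*a1*(a0*b0))"
    unfolding F_def by algebra
  also have "\<dots> \<le> ((1-P)*a0 + P*a1)*((1-Q)*a0*(P*Q) + Q*a1*(P*Q))"
    using P Q a0 a1 m by (intro mult_left_mono add_mono) auto
  also have "\<dots> = P*Q*(a0*a1) - P*Q*((a1-a0)*((1-P)*(1-Q)*a0 - P*Q*a1))" by algebra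
  finally have main: "F*(a0*a1) \<le> P*Q*(a0*a1) - P*Q*((a1-a0)*((1-P)*(1-Q)*a0 - P*Q*a1))" .
  have pos: "0 < a0*a1" using a0 a1 by simp
  have "0 \<le> P*Q*((a1-a0)*((1-P)*(1-Q)*a0 - P*Q*a1))" using PQ a near by auto
  with main have "F*(a0*a1) \<le> P*Q*(a0*a1)" by linarith
  then show "F \<le> P*Q" using pos by (simp add: mult_le_cancel_right)
  show "a0 = a1" if "F = P*Q"
  proof (rule ccontr)
    assume "a0 \<noteq> a1"
    then have "0 < P*Q*((a1-a0)*((1-P)*(1-Q)*a0 - P*Q*a1))" using P Q a near by (intro mult_pos_pos) auto
    then show False using main that by simp
  qed
qed

lemma product_step_far:
  fixes P Q a0 a1 b0 b1 :: real
  assumes P: "0 < P" "P \<le> 1/2" and Q: "0 < Q" "Q \<le> 1/2"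
    and a: "0 \<le> a0" "a0 \<le> a1" "a1 \<le> 1" and b: "0 \<le> b1" "b1 \<le> b0" "b0 \<le> 1"
    and h0: "(1-P)*(1-Q)*(a0*b0) \<le> P*Q*((1-a0)*(1-b0))"
    and h1: "(1-P)*(1-Q)*(a1*b1) \<le> P*Q*((1-a1)*(1-b1))"
    and far: "(1-P)*(1-Q)*a0 \<le> P*Q*a1" "(1-P)*(1-Q)*b1 \<le> P*Q*b0"
  defines "F \<equiv> ((1-P)*a0 + P*a1)*((1-Q)*b1 + Q*b0)"
  shows "F \<le> P*Q"
    and "F = P*Q \<Longrightarrow> \<not> (P = 1/2 \<and> Q = 1/2) \<Longrightarrow> a0 = 0 \<and> b1 = 0 \<and> a1 = 1 \<and> b0 = 1"
proof -
  define \<alpha> \<beta> where "\<alpha> = (1-P)/P" and "\<beta> = (1-Q)/Q"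
  define k where "k = \<alpha>*\<beta>"
  have ab: "1 \<le> \<alpha>" "1 \<le> \<beta>" using P Q by (auto simp: \<alpha>_def \<beta>_def)
  have k1: "1 \<le> k" using mult_mono[OF ab] ab by (simp add: k_def)
  have PQ: "0 < P*Q" using P Q by simp
  have kPQ: "(1-P)*(1-Q) = k*(P*Q)" using P Q by (simp add: k_def \<alpha>_def \<beta>_def)
  have cancel: "u \<le> v" if "P*Q*u \<le> P*Q*v" for u v :: real
    using that PQ by (rule mult_left_le_imp_le)
  have h0': "k*(a0*b0) \<le> (1-a0)*(1-b0)" and h1': "k*(a1*b1) \<le> (1-a1)*(1-b1)"
    and far': "k*a0 \<le> a1" "k*b1 \<le> b0"
    by (rule cancel, use h0 h1 far in \<open>simp add: kPQ mult_ac\<close>)+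
  define F' where "F' = (\<alpha>*a0+a1)*(\<beta>*b1+b0)"
  have FF': "F = P*Q*F'"
  proof -
    have "P*\<alpha> = 1-P" "Q*\<beta> = 1-Q" using P Q by (simp_all add: \<alpha>_def \<beta>_def)
    then show ?thesis unfolding F_def F'_def by algebra
  qed
  \<comment> \<open>For fixed \<open>k = \<alpha> \<beta>\<close> the form \<open>\<alpha> X + \<beta> Y\<close> is convex in \<open>\<alpha>\<close>, so only \<open>\<alpha> = k\<close> and \<open>\<alpha> = 1\<close> matter.\<close>
  have conv: "F' \<le> (k*a0+a1)*(b1+b0) \<or> F' \<le> (k*b1+b0)*(a0+a1)"
  proof (cases "a1*b1 \<le> a0*b0")
    case True
    have "0 \<le> (\<beta>-1)*(\<alpha>*(a0*b0) - a1*b1)"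
      using True ab a b mult_right_mono[of 1 \<alpha> "a0*b0"] by (intro mult_nonneg_nonneg) auto
    also have "\<dots> = (k*a0+a1)*(b1+b0) - F'" by (simp add: F'_def k_def algebra_simps)
    finally show ?thesis by simp
  next
    case False
    have "a0*b0 \<le> \<beta>*(a1*b1)" using False ab a b mult_right_mono[of 1 \<beta> "a1*b1"] by auto
    then have "0 \<le> (\<alpha>-1)*(\<beta>*(a1*b1) - a0*b0)"
      using ab by (intro mult_nonneg_nonneg) auto
    also have "\<dots> = (k*b1+b0)*(a0+a1) - F'" by (simp add: F'_def k_def algebra_simps)
    finally show ?thesis by simp
  qed
  have r: "a0 \<le> 1" "0 \<le> a1" "b1 \<le> 1" "0 \<le> b0" using a b by auto
  note c1 = extremal_form_le[OF k1 a(1) r(1) b(1) r(3) r(2) a(3) r(4) b(3) h0' h1' far'(1)]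
  have h0'': "k*(b0*a0) \<le> (1-b0)*(1-a0)" and h1'': "k*(b1*a1) \<le> (1-b1)*(1-a1)"
    using h0' h1' by (simp_all add: mult.commute)
  note c2 = extremal_form_le[OF k1 b(1) r(3) a(1) r(1) r(4) b(3) r(2) a(3) h1'' h0'' far'(2)]
  have F'1: "F' \<le> 1" using conv c1(1) c2(1) by linarith
  then show "F \<le> P*Q" unfolding FF' using PQ mult_left_mono[of F' 1 "P*Q"] by simp
  show "a0 = 0 \<and> b1 = 0 \<and> a1 = 1 \<and> b0 = 1" if "F = P*Q" "\<not> (P = 1/2 \<and> Q = 1/2)"
  proof -
    have "F' = 1" using that(1) P Q unfolding FF' by simp
    then have or: "(k*a0+a1)*(b1+b0) = 1 \<or> (k*b1+b0)*(a0+a1) = 1"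
      using conv c1(1) c2(1) by linarith
    have "1 < \<alpha> \<or> 1 < \<beta>" using that(2) P Q by (auto simp: \<alpha>_def \<beta>_def)
    then have "1 < k" using ab mult_less_le_imp_less[of 1 \<alpha> 1 \<beta>] mult_le_less_imp_less[of 1 \<alpha> 1 \<beta>]
      by (auto simp: k_def)
    then show ?thesis using or c1(2) c2(2) by blast
  qed
qed

lemma product_step:
  fixes P Q a0 a1 b0 b1 :: real
  assumes P: "0 < P" "P \<le> 1/2" and Q: "0 < Q" "Q \<le> 1/2"
    and a: "0 \<le> a0" "a0 \<le> a1" "a1 \<le> 1" and b: "0 \<le> b1" "b1 \<le> b0" "b0 \<le> 1"
    and h0: "(1-P)*(1-Q)*(a0*b0) \<le> P*Q*((1-a0)*(1-b0))"
    and h1: "(1-P)*(1-Q)*(a1*b1) \<le> P*Q*((1-a1)*(1-b1))"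
    and m0: "a0*b0 \<le> P*Q" and m1: "a1*b1 \<le> P*Q"
  defines "F \<equiv> ((1-P)*a0 + P*a1)*((1-Q)*b1 + Q*b0)"
  shows "F \<le> P*Q"
    and "F = P*Q \<Longrightarrow> \<not> (P = 1/2 \<and> Q = 1/2) \<Longrightarrow>
      a0 = a1 \<and> b0 = b1 \<and> a0*b1 = P*Q \<or> a0 = 0 \<and> b1 = 0 \<and> a1 = 1 \<and> b0 = 1"
proof -
  have m0': "b0*a0 \<le> Q*P" and m1': "b1*a1 \<le> Q*P" using m0 m1 by (simp_all add: mult.commute)
  have F': "((1-Q)*b1 + Q*b0)*((1-P)*a0 + P*a1) = F" by (simp add: F_def)
  note n1 = product_step_near[OF P Q a(1,2) m0 m1, folded F_def]
  note n2 = product_step_near[OF Q P b(1,2) m1' m0', unfolded F']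
  note f = product_step_far[OF P Q a b h0 h1, folded F_def]
  consider "P*Q*a1 < (1-P)*(1-Q)*a0" | "Q*P*b0 < (1-Q)*(1-P)*b1"
    | "(1-P)*(1-Q)*a0 \<le> P*Q*a1" "(1-P)*(1-Q)*b1 \<le> P*Q*b0"
    by (metis linorder_not_less mult.commute)
  note cases = this
  show "F \<le> P*Q" using cases n1(1) n2(1) f(1) by cases (auto simp: mult.commute)
  show "a0 = a1 \<and> b0 = b1 \<and> a0*b1 = P*Q \<or> a0 = 0 \<and> b1 = 0 \<and> a1 = 1 \<and> b0 = 1"
    if F: "F = P*Q" and nh: "\<not> (P = 1/2 \<and> Q = 1/2)"
  proof -
    have PQ: "0 < P*Q" using P Q by simp
    have flat: "a0*b1 = P*Q \<and> a0 = a1 \<and> b0 = b1" if "a0 = a1 \<or> b0 = b1"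
      using that
    proof
      assume e: "a0 = a1"
      have "(1-Q)*(P*Q - a0*b1) + Q*(P*Q - a0*b0) = 0"
        using F unfolding F_def e by (simp add: algebra_simps)
      moreover have "0 \<le> (1-Q)*(P*Q - a0*b1)" "0 \<le> Q*(P*Q - a0*b0)" using Q m0 m1 e by auto
      ultimately have "(1-Q)*(P*Q - a0*b1) = 0" "Q*(P*Q - a0*b0) = 0" by linarith+
      then have "a0*b1 = P*Q" "a0*b0 = P*Q" using Q by auto
      moreover from this have "a0 \<noteq> 0" using PQ by auto
      ultimately show ?thesis using e mult_left_cancel[of a0 b0 b1] by simp
    next
      assume e: "b0 = b1"
      have "(1-P)*(P*Q - a0*b1) + P*(P*Q - a1*b1) = 0"
        using F unfolding F_def e by (simp add: algebra_simps)
      moreover have "0 \<le> (1-P)*(P*Q - a0*b1)" "0 \<le> P*(P*Q - a1*b1)" using P m0 m1 e by auto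
      ultimately have "(1-P)*(P*Q - a0*b1) = 0" "P*(P*Q - a1*b1) = 0" by linarith+
      then have "a0*b1 = P*Q" "a1*b1 = P*Q" using P by auto
      moreover from this have "b1 \<noteq> 0" using PQ by auto
      ultimately show ?thesis using e mult_right_cancel[of b1 a0 a1] by simp
    qed
    show ?thesis using cases
    proof cases
      case 1
      then show ?thesis using flat n1(2) F by blast
    next
      case 2
      have "F = Q*P" using F by simp
      then have "b1 = b0" using n2(2) 2 by blast
      then show ?thesis using flat by metis
    next
      case 3
      then show ?thesis using f(2) F nh by blast
    qed
  qed
qed

lemma mult_mono_eqD:
  fixes a b u v :: real
  assumes "0 \<le> a" "a \<le> u" "0 \<le> b" "b \<le> v" "a*b = u*v" "0 < a*b"
  shows "a = u" "b = v"
proof -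
  have pos: "0 < a" "0 < b" using assms(1,3,6) by (auto simp: zero_less_mult_iff)
  then have "u*b \<le> u*v" "a*v \<le> u*v" using assms by (auto intro!: mult_mono)
  then have "u*b \<le> a*b" "a*v \<le> a*b" using assms(5) by auto
  then show "a = u" "b = v" using pos assms(2,4) by auto
qed

subsection \<open>Product measures\<close>

definition cube_measure :: "'a set \<Rightarrow> ('a \<Rightarrow> real) \<Rightarrow> 'a set set \<Rightarrow> real" where
  "cube_measure I p U = (\<Sum>x\<in>U. (\<Prod>l\<in>x. p l) * (\<Prod>k\<in>I - x. 1 - p k))"

definition star :: "'a set \<Rightarrow> 'a \<Rightarrow> 'a set set" where
  "star I l = {x \<in> Pow I. l \<in> x}"

definition low :: "'a \<Rightarrow> 'a set set \<Rightarrow> 'a set set" where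
  "low j U = {x \<in> U. j \<notin> x}"

definition high :: "'a \<Rightarrow> 'a set set \<Rightarrow> 'a set set" where
  "high j U = {x. j \<notin> x \<and> insert j x \<in> U}"

definition cross_inter :: "'a set set \<Rightarrow> 'a set set \<Rightarrow> bool" where
  "cross_inter U V \<longleftrightarrow> (\<forall>x\<in>U. \<forall>y\<in>V. x \<inter> y \<noteq> {})"

definition prob_le :: "'a set \<Rightarrow> ('a \<Rightarrow> real) \<Rightarrow> real \<Rightarrow> bool" where
  "prob_le I p P \<longleftrightarrow> finite I \<and> (\<forall>l\<in>I. 0 < p l \<and> p l \<le> P)"

lemma prob_le_insert: "prob_le (insert j I) p P \<Longrightarrow> prob_le I p P"
  by (auto simp: prob_le_def)

lemma cross_inter_commute: "cross_inter U V \<longleftrightarrow> cross_inter V U"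
  by (auto simp: cross_inter_def Int_commute)

subsection \<open>Sections of a family\<close>

lemma low_subset: "U \<subseteq> Pow (insert j I) \<Longrightarrow> low j U \<subseteq> Pow I"
  and high_subset: "U \<subseteq> Pow (insert j I) \<Longrightarrow> high j U \<subseteq> Pow I"
  by (auto simp: low_def high_def)

lemma sections_eqI:
  assumes "low j U = low j V" "high j U = high j V"
  shows "U = V"
proof -
  have "x \<in> U \<longleftrightarrow> x \<in> V" for x
  proof (cases "j \<in> x")
    case True
    then obtain y where y: "x = insert j y" "j \<notin> y" by (meson mk_disjoint_insert)
    then have "x \<in> W \<longleftrightarrow> y \<in> high j W" for W by (simp add: high_def)
    then show ?thesis using assms(2) by simp
  next
    case False
    then show ?thesis using assms(1) by (auto simp: low_def)
  qed
  then show ?thesis by blast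
qed

lemma sections_star:
  assumes "j \<notin> I"
  shows "low j (star (insert j I) j) = {}" "high j (star (insert j I) j) = Pow I"
    and "l \<noteq> j \<Longrightarrow> low j (star (insert j I) l) = star I l"
    and "l \<noteq> j \<Longrightarrow> high j (star (insert j I) l) = star I l"
  using assms by (auto simp: low_def high_def star_def)

lemma eq_starI:
  assumes "j \<notin> I"
  shows "low j U = {} \<Longrightarrow> high j U = Pow I \<Longrightarrow> U = star (insert j I) j"
    and "l \<in> I \<Longrightarrow> low j U = star I l \<Longrightarrow> high j U = star I l \<Longrightarrow> U = star (insert j I) l"
proof -
  show "U = star (insert j I) j" if "low j U = {}" "high j U = Pow I"
    by (rule sections_eqI[of j]) (simp_all add: sections_star[OF assms] that)
  show "U = star (insert j I) l" if l: "l \<in> I" "low j U = star I l" "high j U = star I l"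
  proof (rule sections_eqI[of j])
    have "l \<noteq> j" using l(1) assms by auto
    then show "low j U = low j (star (insert j I) l)" "high j U = high j (star (insert j I) l)"
      using l by (simp_all add: sections_star[OF assms])
  qed
qed

lemma cross_inter_sections:
  assumes "cross_inter U V"
  shows "cross_inter (low j U) (low j V \<union> high j V)" "cross_inter (low j U \<union> high j U) (low j V)"
  using assms unfolding cross_inter_def low_def high_def by fastforce+

lemma cube_measure_insert:
  assumes "finite I" "j \<notin> I" "U \<subseteq> Pow (insert j I)"
  shows "cube_measure (insert j I) p U
    = (1 - p j) * cube_measure I p (low j U) + p j * cube_measure I p (high j U)"
proof -
  let ?w = "\<lambda>I x. (\<Prod>l\<in>x. p l) * (\<Prod>k\<in>I - x. 1 - p k)"
  have fin: "finite (low j U)" "finite (high j U)"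
    using low_subset[OF assms(3)] high_subset[OF assms(3)] assms(1)
    by (auto intro: finite_subset)
  have U: "U = low j U \<union> insert j ` high j U"
  proof (rule sections_eqI[of j])
    show "low j U = low j (low j U \<union> insert j ` high j U)" by (auto simp: low_def)
    have "insert j y \<in> insert j ` high j U \<longleftrightarrow> insert j y \<in> U" if "j \<notin> y" for y
      using that by (auto simp: high_def)
    then show "high j U = high j (low j U \<union> insert j ` high j U)" by (auto simp: high_def low_def)
  qed
  have disj: "low j U \<inter> insert j ` high j U = {}" by (auto simp: low_def)
  have inj: "inj_on (insert j) (high j U)"
    by (rule inj_onI) (auto simp: high_def insert_ident)
  have wl: "?w (insert j I) x = (1 - p j) * ?w I x" if "x \<in> low j U" for x
  proof -
    have "insert j I - x = insert j (I - x)" using that by (auto simp: low_def)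
    then show ?thesis using assms by simp
  qed
  have wh: "?w (insert j I) (insert j x) = p j * ?w I x" if "x \<in> high j U" for x
  proof -
    have "finite x" using that high_subset[OF assms(3)] assms(1) by (auto intro: finite_subset)
    moreover have "insert j I - insert j x = I - x" using assms(2) by auto
    ultimately show ?thesis using that by (simp add: high_def)
  qed
  have "cube_measure (insert j I) p U
      = sum (?w (insert j I)) (low j U) + sum (?w (insert j I)) (insert j ` high j U)"
    unfolding cube_measure_def by (subst U) (use fin disj in \<open>simp add: sum.union_disjoint\<close>)
  also have "sum (?w (insert j I)) (insert j ` high j U) = (\<Sum>x\<in>high j U. p j * ?w I x)"
    using inj wh by (simp add: sum.reindex)
  also have "sum (?w (insert j I)) (low j U) = (\<Sum>x\<in>low j U. (1 - p j) * ?w I x)"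
    using wl by (rule sum.cong[OF refl])
  finally show ?thesis by (simp add: cube_measure_def sum_distrib_left)
qed

lemma cube_measure_cong:
  assumes "U \<subseteq> Pow I" "\<And>l. l \<in> I \<Longrightarrow> p l = q l"
  shows "cube_measure I p U = cube_measure I q U"
  unfolding cube_measure_def using assms
  by (intro sum.cong arg_cong2[where f = "(*)"] prod.cong refl) auto

lemma cube_measure_empty [simp]: "cube_measure I p {} = 0"
  by (simp add: cube_measure_def)

lemma cube_measure_Pow: "finite I \<Longrightarrow> cube_measure I p (Pow I) = 1"
proof (induction I rule: finite_induct)
  case empty
  then show ?case by (simp add: cube_measure_def)
next
  case (insert j I)
  then have "low j (Pow (insert j I)) = Pow I" "high j (Pow (insert j I)) = Pow I"
    by (auto simp: low_def high_def)
  with insert show ?case by (simp add: cube_measure_insert)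
qed

lemma cube_measure_star:
  assumes "finite I" "l \<in> I"
  shows "cube_measure I p (star I l) = p l"
proof -
  obtain J where J: "I = insert l J" "l \<notin> J" using assms(2) by (meson mk_disjoint_insert)
  then have "finite J" "star I l \<subseteq> Pow (insert l J)" using assms by (auto simp: star_def)
  then show ?thesis unfolding J(1) using J(2)
    by (simp add: cube_measure_insert sections_star cube_measure_Pow)
qed

lemma cube_measure_mono:
  assumes p: "prob_le I p P" "P < 1" and UV: "U \<subseteq> V" "V \<subseteq> Pow I"
  shows "cube_measure I p U \<le> cube_measure I p V"
    and "cube_measure I p U = cube_measure I p V \<Longrightarrow> U = V"
proof -
  let ?w = "\<lambda>x. (\<Prod>l\<in>x. p l) * (\<Prod>k\<in>I - x. 1 - p k)"
  have fin: "finite V" using p UV(2) by (auto simp: prob_le_def intro: finite_subset)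
  have pos: "0 < ?w x" if "x \<in> V" for x
    using p UV(2) that by (intro mult_pos_pos prod_pos) (force simp: prob_le_def)+
  have eq: "cube_measure I p V = cube_measure I p U + sum ?w (V - U)"
    unfolding cube_measure_def by (subst sum.subset_diff[OF UV(1) fin]) simp
  show "cube_measure I p U \<le> cube_measure I p V"
  proof -
    have "0 \<le> sum ?w (V - U)" by (rule sum_nonneg) (use pos in \<open>blast intro: less_imp_le\<close>)
    then show ?thesis unfolding eq by simp
  qed
  show "U = V" if "cube_measure I p U = cube_measure I p V"
  proof (rule ccontr)
    assume "U \<noteq> V"
    then have "0 < sum ?w (V - U)"
      by (intro sum_pos) (use fin pos UV(1) in blast)+
    then show False using eq that by simp
  qed
qed

lemma cube_measure_bounds:
  assumes "prob_le I p P" "P < 1" "U \<subseteq> Pow I"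
  shows "0 \<le> cube_measure I p U" "cube_measure I p U \<le> 1"
    and "cube_measure I p U = 0 \<Longrightarrow> U = {}" "cube_measure I p U = 1 \<Longrightarrow> U = Pow I"
  using cube_measure_mono[OF assms(1,2) empty_subsetI assms(3)]
    cube_measure_mono[OF assms order.refl] cube_measure_Pow[of I p] assms(1)
  by (auto simp: prob_le_def)

lemma section_le:
  assumes p: "prob_le (insert j I) p P" "P < 1" and j: "j \<notin> I" and U: "U \<subseteq> Pow (insert j I)"
  defines "u \<equiv> (1-P) * cube_measure I p (low j U) + P * cube_measure I p (low j U \<union> high j U)"
  shows "cube_measure (insert j I) p U \<le> u"
    and "cube_measure (insert j I) p U = u \<Longrightarrow> low j U \<subseteq> high j U \<and> (p j = P \<or> low j U = high j U)"
proof -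
  note sub = low_subset[OF U] high_subset[OF U]
  have pI: "prob_le I p P" using p(1) by (rule prob_le_insert)
  have pj: "0 < p j" "p j \<le> P" using p by (auto simp: prob_le_def)
  define a0 h a1 where "a0 = cube_measure I p (low j U)" and "h = cube_measure I p (high j U)"
    and "a1 = cube_measure I p (low j U \<union> high j U)"
  have sub': "low j U \<union> high j U \<subseteq> Pow I" using sub by simp
  note ml = cube_measure_mono[OF pI p(2) Un_upper1 sub']
  note mh = cube_measure_mono[OF pI p(2) Un_upper2 sub']
  have le: "a0 \<le> a1" "h \<le> a1" using ml(1) mh(1) by (auto simp: a0_def a1_def h_def)
  have ins: "cube_measure (insert j I) p U = (1 - p j)*a0 + p j*h"
    unfolding a0_def h_def using pI j U by (simp add: cube_measure_insert prob_le_def)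
  have diff: "u - cube_measure (insert j I) p U = (P - p j)*(a1-a0) + p j*(a1-h)"
    unfolding ins u_def a0_def[symmetric] a1_def[symmetric] by (simp add: algebra_simps)
  have nn: "0 \<le> (P - p j)*(a1-a0)" "0 \<le> p j*(a1-h)" using pj le by auto
  show "cube_measure (insert j I) p U \<le> u" using diff nn by linarith
  show "low j U \<subseteq> high j U \<and> (p j = P \<or> low j U = high j U)" if "cube_measure (insert j I) p U = u"
  proof -
    have "(P - p j)*(a1-a0) = 0" "p j*(a1-h) = 0" using diff nn that by linarith+
    then have "h = a1" "p j = P \<or> a0 = a1" using pj by auto
    then have "high j U = low j U \<union> high j U" "p j = P \<or> low j U = low j U \<union> high j U"
      using ml(2) mh(2) by (auto simp: a0_def h_def a1_def)
    then show ?thesis by blast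
  qed
qed

lemma cross_inter_Pow_empty:
  assumes "U \<subseteq> Pow {}" "V \<subseteq> Pow {}" "cross_inter U V"
  shows "U = {} \<or> V = {}"
  using assms by (auto simp: cross_inter_def)

subsection \<open>Two inequalities for cross-intersecting families\<close>

lemma cross_inter_hoffman:
  assumes PQ: "0 < P" "P \<le> 1/2" "0 < Q" "Q \<le> 1/2"
    and "prob_le I p P" "prob_le I q Q" "U \<subseteq> Pow I" "V \<subseteq> Pow I" "cross_inter U V"
  shows "(1-P)*(1-Q)*(cube_measure I p U * cube_measure I q V)
    \<le> P*Q*((1 - cube_measure I p U)*(1 - cube_measure I q V))"
proof -
  have "finite I" using assms by (simp add: prob_le_def)
  then show ?thesis using assms(5-)
  proof (induction I arbitrary: U V rule: finite_induct)
    case empty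
    have "cube_measure {} p U \<le> 1" "cube_measure {} q V \<le> 1"
      using cube_measure_bounds(2)[OF empty(1) _ empty(3)] cube_measure_bounds(2)[OF empty(2) _ empty(4)] PQ
      by auto
    then show ?case using cross_inter_Pow_empty[OF empty.prems(3-5)] PQ by auto
  next
    case (insert j I)
    note p = insert.prems(1) and q = insert.prems(2)
    have PQ1: "P < 1" "Q < 1" using PQ by auto
    have pI: "prob_le I p P" and qI: "prob_le I q Q" using p q prob_le_insert by metis+
    note sU = low_subset[OF insert.prems(3)] high_subset[OF insert.prems(3)]
    note sV = low_subset[OF insert.prems(4)] high_subset[OF insert.prems(4)]
    note cr = cross_inter_sections[OF insert.prems(5), of j]
    define a0 a1 b0 b1 where "a0 = cube_measure I p (low j U)"
      and "a1 = cube_measure I p (low j U \<union> high j U)"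
      and "b0 = cube_measure I q (low j V \<union> high j V)" and "b1 = cube_measure I q (low j V)"
    define a b where "a = (1-P)*a0 + P*a1" and "b = (1-Q)*b1 + Q*b0"
    have bd: "0 \<le> a0" "a0 \<le> a1" "a1 \<le> 1" "0 \<le> b1" "b1 \<le> b0" "b0 \<le> 1"
      unfolding a0_def a1_def b0_def b1_def using sU sV
      by (auto intro!: cube_measure_bounds(1,2)[OF pI PQ1(1)] cube_measure_bounds(1,2)[OF qI PQ1(2)]
          cube_measure_mono(1)[OF pI PQ1(1)] cube_measure_mono(1)[OF qI PQ1(2)])
    have h0: "(1-P)*(1-Q)*(a0*b0) \<le> P*Q*((1-a0)*(1-b0))"
      unfolding a0_def b0_def using insert.IH[OF pI qI _ _ cr(1)] sU sV by simp
    have h1: "(1-P)*(1-Q)*(a1*b1) \<le> P*Q*((1-a1)*(1-b1))"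
      unfolding a1_def b1_def using insert.IH[OF pI qI _ _ cr(2)] sU sV by simp
    have h: "(1-P)*(1-Q)*(a*b) \<le> P*Q*((1-a)*(1-b))"
      unfolding a_def b_def by (rule hoffman_step[OF PQ bd h0 h1])
    have le: "cube_measure (insert j I) p U \<le> a" "cube_measure (insert j I) q V \<le> b"
      unfolding a_def b_def a0_def a1_def b0_def b1_def
      using section_le(1)[OF p PQ1(1) insert.hyps(2) insert.prems(3)]
        section_le(1)[OF q PQ1(2) insert.hyps(2) insert.prems(4)] by auto
    have nn: "0 \<le> cube_measure (insert j I) p U" "0 \<le> cube_measure (insert j I) q V"
      using cube_measure_bounds(1) p q PQ1 insert.prems by blast+
    have "a \<le> 1" "b \<le> 1" unfolding a_def b_def using bd PQ by (auto intro!: convex_bound_le)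
    then have "P*Q*((1-a)*(1-b))
      \<le> P*Q*((1 - cube_measure (insert j I) p U)*(1 - cube_measure (insert j I) q V))"
      using le PQ by (intro mult_left_mono mult_mono) auto
    moreover have "(1-P)*(1-Q)*(cube_measure (insert j I) p U * cube_measure (insert j I) q V)
        \<le> (1-P)*(1-Q)*(a*b)"
      using le nn PQ by (intro mult_left_mono mult_mono) auto
    ultimately show ?case using h by linarith
  qed
qed

lemma cross_inter_product:
  assumes PQ: "0 < P" "P \<le> 1/2" "0 < Q" "Q \<le> 1/2"
    and "prob_le I p P" "prob_le I q Q" "U \<subseteq> Pow I" "V \<subseteq> Pow I" "cross_inter U V"
  shows "cube_measure I p U * cube_measure I q V \<le> P*Q \<and>
    (cube_measure I p U * cube_measure I q V = P*Q \<longrightarrow> \<not> (P = 1/2 \<and> Q = 1/2) \<longrightarrow>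
      (\<exists>l\<in>I. p l = P \<and> q l = Q \<and> U = star I l \<and> V = star I l))"
proof -
  have "finite I" using assms by (simp add: prob_le_def)
  then show ?thesis using assms(5-)
  proof (induction I arbitrary: U V rule: finite_induct)
    case empty
    then show ?case using cross_inter_Pow_empty[OF empty.prems(3-5)] PQ by auto
  next
    case (insert j I)
    note p = insert.prems(1) and q = insert.prems(2)
    have PQ1: "P < 1" "Q < 1" using PQ by auto
    have pI: "prob_le I p P" and qI: "prob_le I q Q" using p q prob_le_insert by metis+
    note sU = low_subset[OF insert.prems(3)] high_subset[OF insert.prems(3)]
    note sV = low_subset[OF insert.prems(4)] high_subset[OF insert.prems(4)]
    note cr = cross_inter_sections[OF insert.prems(5), of j]
    have sU': "low j U \<union> high j U \<subseteq> Pow I" and sV': "low j V \<union> high j V \<subseteq> Pow I"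
      using sU sV by auto
    define a0 a1 b0 b1 where "a0 = cube_measure I p (low j U)"
      and "a1 = cube_measure I p (low j U \<union> high j U)"
      and "b0 = cube_measure I q (low j V \<union> high j V)" and "b1 = cube_measure I q (low j V)"
    note defs = a0_def a1_def b0_def b1_def
    define a b where "a = (1-P)*a0 + P*a1" and "b = (1-Q)*b1 + Q*b0"
    have bd: "0 \<le> a0" "a0 \<le> a1" "a1 \<le> 1" "0 \<le> b1" "b1 \<le> b0" "b0 \<le> 1"
      unfolding defs using sU sV
      by (auto intro!: cube_measure_bounds(1,2)[OF pI PQ1(1)] cube_measure_bounds(1,2)[OF qI PQ1(2)]
          cube_measure_mono(1)[OF pI PQ1(1)] cube_measure_mono(1)[OF qI PQ1(2)])
    note hoff = cross_inter_hoffman[OF PQ pI qI]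
    note st = product_step[OF PQ bd hoff[OF sU(1) sV' cr(1), folded defs]
        hoff[OF sU' sV(1) cr(2), folded defs]
        conjunct1[OF insert.IH[OF pI qI sU(1) sV' cr(1)], folded defs]
        conjunct1[OF insert.IH[OF pI qI sU' sV(1) cr(2)], folded defs], folded a_def b_def]
    note sec = section_le[OF p PQ1(1) insert.hyps(2) insert.prems(3), folded defs, folded a_def]
      section_le[OF q PQ1(2) insert.hyps(2) insert.prems(4), folded defs, folded b_def]
    define x y where "x = cube_measure (insert j I) p U" and "y = cube_measure (insert j I) q V"
    note sec = sec[folded x_def y_def]
    have nn: "0 \<le> x" "0 \<le> y"
      using cube_measure_bounds(1) p q PQ1 insert.prems unfolding x_def y_def by blast+
    have xy: "x*y \<le> a*b" using sec(1,3) nn by (intro mult_mono) auto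
    have "\<exists>l\<in>insert j I. p l = P \<and> q l = Q \<and> U = star (insert j I) l \<and> V = star (insert j I) l"
      if eq: "x*y = P*Q" and nh: "\<not> (P = 1/2 \<and> Q = 1/2)"
    proof -
      have ab: "a*b = P*Q" using eq xy st(1) by simp
      then have "x = a" "y = b" using mult_mono_eqD[OF nn(1) sec(1) nn(2) sec(3)] eq PQ by auto
      then have U: "low j U \<subseteq> high j U" "p j = P \<or> low j U = high j U"
        and V: "low j V \<subseteq> high j V" "q j = Q \<or> low j V = high j V"
        using sec by auto
      from U V have Un: "low j U \<union> high j U = high j U" "low j V \<union> high j V = high j V" by auto
      from st(2)[OF ab nh] show ?thesis
      proof (elim disjE conjE)
        assume h: "a0 = a1" "b0 = b1" "a0*b1 = P*Q"
        have eqs: "low j U = high j U" "low j V = high j V"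
          using h(1,2) cube_measure_mono(2)[OF pI PQ1(1) U(1) sU(2)]
            cube_measure_mono(2)[OF qI PQ1(2) V(1) sV(2)] unfolding defs Un by auto
        have "cross_inter (low j U) (low j V)"
          using cr(1) by (auto simp: cross_inter_def)
        then obtain l where l: "l \<in> I" "p l = P" "q l = Q" "low j U = star I l" "low j V = star I l"
          using insert.IH[OF pI qI sU(1) sV(1)] h(3) nh unfolding defs by blast
        have "high j U = star I l" "high j V = star I l"
          unfolding eqs[symmetric] by (fact l(4), fact l(5))
        then have "U = star (insert j I) l" "V = star (insert j I) l"
          using eq_starI(2)[OF insert.hyps(2) l(1,4)] eq_starI(2)[OF insert.hyps(2) l(1,5)] by blast+
        then show ?thesis using l(1-3) by blast
      next
        assume h: "a0 = 0" "b1 = 0" "a1 = 1" "b0 = 1"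
        have e: "low j U = {}" "high j U = Pow I" "low j V = {}" "high j V = Pow I"
          using h cube_measure_bounds(3,4)[OF pI PQ1(1)] cube_measure_bounds(3,4)[OF qI PQ1(2)] sU sV
          unfolding defs Un by auto
        then have "p j = P" "q j = Q" using U V by auto
        moreover have "U = star (insert j I) j" "V = star (insert j I) j"
          by (rule eq_starI(1)[OF insert.hyps(2) e(1,2)], rule eq_starI(1)[OF insert.hyps(2) e(3,4)])
        ultimately show ?thesis by blast
      qed
    qed
    then show ?case using xy st(1) unfolding x_def y_def by auto
  qed
qed

subsection \<open>The symmetric case\<close>

lemma cross_inter_sum_le_1:
  assumes "prob_le I p (1/2)" "prob_le I q (1/2)" "U \<subseteq> Pow I" "V \<subseteq> Pow I" "cross_inter U V"
  shows "cube_measure I p U + cube_measure I q V \<le> 1"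
  using cross_inter_hoffman[OF _ _ _ _ assms] by (simp add: algebra_simps)

lemma sum_eq_1_sections:
  assumes p: "prob_le (insert j I) p (1/2)" and q: "prob_le (insert j I) q (1/2)" and j: "j \<notin> I"
    and U: "U \<subseteq> Pow (insert j I)" and V: "V \<subseteq> Pow (insert j I)" and cross: "cross_inter U V"
    and eq: "cube_measure (insert j I) p U + cube_measure (insert j I) q V = 1"
  shows "low j U \<subseteq> high j U" "low j V \<subseteq> high j V"
    and "cube_measure I p (low j U) + cube_measure I q (high j V) = 1"
    and "cube_measure I p (high j U) + cube_measure I q (low j V) = 1"
    and "p j = 1/2 \<and> q j = 1/2 \<or> low j U = high j U \<and> low j V = high j V"
    and "cross_inter (low j U) (high j V)" "cross_inter (high j U) (low j V)"
proof -
  have pI: "prob_le I p (1/2)" and qI: "prob_le I q (1/2)" using p q prob_le_insert by metis+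
  have half: "(1/2::real) < 1" by simp
  note sU = low_subset[OF U] high_subset[OF U] and sV = low_subset[OF V] high_subset[OF V]
  note cr = cross_inter_sections[OF cross, of j]
  note secU = section_le[OF p half j U] and secV = section_le[OF q half j V]
  have sU': "low j U \<union> high j U \<subseteq> Pow I" and sV': "low j V \<union> high j V \<subseteq> Pow I"
    using sU sV by auto
  have le: "cube_measure I p (low j U) + cube_measure I q (low j V \<union> high j V) \<le> 1"
    "cube_measure I p (low j U \<union> high j U) + cube_measure I q (low j V) \<le> 1"
    using cross_inter_sum_le_1[OF pI qI sU(1) sV' cr(1)] cross_inter_sum_le_1[OF pI qI sU' sV(1) cr(2)]
    by auto
  then have tight: "cube_measure (insert j I) p U
      = (1-1/2) * cube_measure I p (low j U) + 1/2 * cube_measure I p (low j U \<union> high j U)"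
    "cube_measure (insert j I) q V
      = (1-1/2) * cube_measure I q (low j V) + 1/2 * cube_measure I q (low j V \<union> high j V)"
    and sums: "cube_measure I p (low j U) + cube_measure I q (low j V \<union> high j V) = 1"
    "cube_measure I p (low j U \<union> high j U) + cube_measure I q (low j V) = 1"
    using secU(1) secV(1) eq by simp_all
  show lU: "low j U \<subseteq> high j U" and lV: "low j V \<subseteq> high j V"
    using secU(2)[OF tight(1)] secV(2)[OF tight(2)] by auto
  then have Un: "low j U \<union> high j U = high j U" "low j V \<union> high j V = high j V" by auto
  show s: "cube_measure I p (low j U) + cube_measure I q (high j V) = 1"
    "cube_measure I p (high j U) + cube_measure I q (low j V) = 1"
    using sums unfolding Un by auto
  show "cross_inter (low j U) (high j V)" "cross_inter (high j U) (low j V)"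
    using cr unfolding Un by auto
  have "low j U = high j U \<longleftrightarrow> low j V = high j V"
    using cube_measure_mono(2)[OF pI half lU sU(2)] cube_measure_mono(2)[OF qI half lV sV(2)] s
    by (metis add.commute add_left_cancel)
  then show "p j = 1/2 \<and> q j = 1/2 \<or> low j U = high j U \<and> low j V = high j V"
    using secU(2)[OF tight(1)] secV(2)[OF tight(2)] by auto
qed

lemma cube_measure_equal_sections:
  assumes "finite I" "j \<notin> I" "U \<subseteq> Pow (insert j I)" "low j U = high j U"
  shows "cube_measure (insert j I) p U = cube_measure I p (low j U)"
  using assms by (simp add: cube_measure_insert algebra_simps)

lemma card_if_insert_le:
  assumes "finite W" "j \<notin> W" "card (if c then insert j W else W) \<le> k"
  shows "card W \<le> k" "c \<Longrightarrow> card W \<le> k - 1"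
  using assms by (auto split: if_splits)

lemma cross_inter_sum_eq_1:
  assumes "prob_le I p (1/2)" "prob_le I q (1/2)" "U \<subseteq> Pow I" "V \<subseteq> Pow I" "cross_inter U V"
    and "cube_measure I p U + cube_measure I q V = 1"
    and "card {l\<in>I. p l = 1/2 \<and> q l = 1/2} \<le> 1"
  shows "U = {} \<or> V = {} \<or> (\<exists>l\<in>I. p l = 1/2 \<and> q l = 1/2 \<and> U = star I l \<and> V = star I l)"
proof -
  have "finite I" using assms by (simp add: prob_le_def)
  then show ?thesis using assms
  proof (induction I arbitrary: U V rule: finite_induct)
    case empty
    then show ?case using cross_inter_Pow_empty by blast
  next
    case (insert j I)
    note p = insert.prems(1) and q = insert.prems(2) and U = insert.prems(3) and V = insert.prems(4)
    have pI: "prob_le I p (1/2)" and qI: "prob_le I q (1/2)" using p q prob_le_insert by metis+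
    have half: "(1/2::real) < 1" by simp
    note sU = low_subset[OF U] high_subset[OF U] and sV = low_subset[OF V] high_subset[OF V]
    note sec = sum_eq_1_sections[OF p q insert.hyps(2) U V insert.prems(5,6)]
    let ?w = "{l\<in>I. p l = 1/2 \<and> q l = 1/2}"
    have w: "{l\<in>insert j I. p l = 1/2 \<and> q l = 1/2}
      = (if p j = 1/2 \<and> q j = 1/2 then insert j ?w else ?w)" by auto
    have fw: "finite ?w" "j \<notin> ?w" using insert.hyps by auto
    have cw: "card ?w \<le> 1" "p j = 1/2 \<and> q j = 1/2 \<Longrightarrow> ?w = {}"
      using card_if_insert_le[OF fw insert.prems(7)[unfolded w]] fw(1) by simp_all
    have nonempty: "low j W \<noteq> {} \<or> high j W \<noteq> {}" if "W \<noteq> {}" for W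
      using that sections_eqI[of j W "{}"] by (auto simp: low_def high_def)
    show ?case
    proof (cases "low j U = high j U \<and> low j V = high j V")
      case True
      have "low j U = {} \<or> low j V = {} \<or>
        (\<exists>l\<in>I. p l = 1/2 \<and> q l = 1/2 \<and> low j U = star I l \<and> low j V = star I l)"
        using insert.IH[OF pI qI sU(1) sV(1) _ _ cw(1)] True sec(3,6) by simp
      then show ?thesis
        using True nonempty eq_starI(2)[OF insert.hyps(2)] by (metis insertI2)
    next
      case False
      then have pq: "p j = 1/2" "q j = 1/2" using sec(5) by auto
      then have no: "\<not> (\<exists>l\<in>I. p l = 1/2 \<and> q l = 1/2 \<and> R l)" for R using cw(2) by blast
      have A: "low j U = {} \<or> high j V = {}" and B: "high j U = {} \<or> low j V = {}"
        using insert.IH[OF pI qI sU(1) sV(2) sec(6,3) cw(1)]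
          insert.IH[OF pI qI sU(2) sV(1) sec(7,4) cw(1)] no by blast+
      show ?thesis
      proof (cases "U = {} \<or> V = {}")
        case False
        then have "high j U \<noteq> {}" "high j V \<noteq> {}" using nonempty sec(1,2) by blast+
        then have e: "low j U = {}" "low j V = {}" using A B by auto
        then have "high j U = Pow I" "high j V = Pow I"
          using sec(3,4) cube_measure_bounds(4)[OF pI half sU(2)] cube_measure_bounds(4)[OF qI half sV(2)]
          by auto
        then show ?thesis using e pq eq_starI(1)[OF insert.hyps(2)] by blast
      qed auto
    qed
  qed
qed

lemma cross_inter_product_half:
  assumes "prob_le I p (1/2)" "prob_le I q (1/2)" "U \<subseteq> Pow I" "V \<subseteq> Pow I" "cross_inter U V"
    and "cube_measure I p U * cube_measure I q V = 1/4"
    and "card {l\<in>I. p l = 1/2 \<and> q l = 1/2} \<le> 2"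
  shows "\<exists>l\<in>I. p l = 1/2 \<and> q l = 1/2 \<and> U = star I l \<and> V = star I l"
proof -
  have "finite I" using assms by (simp add: prob_le_def)
  then show ?thesis using assms
  proof (induction I arbitrary: U V rule: finite_induct)
    case empty
    then have "U = {} \<or> V = {}" using cross_inter_Pow_empty by blast
    then show ?case using empty.prems(6) by auto
  next
    case (insert j I)
    note p = insert.prems(1) and q = insert.prems(2) and U = insert.prems(3) and V = insert.prems(4)
    have pI: "prob_le I p (1/2)" and qI: "prob_le I q (1/2)" using p q prob_le_insert by metis+
    have half: "(1/2::real) < 1" by simp
    note sU = low_subset[OF U] high_subset[OF U] and sV = low_subset[OF V] high_subset[OF V]
    define a b where "a = cube_measure (insert j I) p U" and "b = cube_measure (insert j I) q V"
    have ab: "a*b = 1/4" using insert.prems(6) by (simp add: a_def b_def)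
    have nn: "0 \<le> a" "0 \<le> b"
      using cube_measure_bounds(1)[OF p half U] cube_measure_bounds(1)[OF q half V]
      by (auto simp: a_def b_def)
    have le: "a + b \<le> 1"
      using cross_inter_sum_le_1[OF p q U V insert.prems(5)] by (simp add: a_def b_def)
    have "(a+b)^2 \<le> 1^2" using le nn by (intro power_mono) auto
    moreover have "(a+b)^2 = (a-b)^2 + 1" using ab by (simp add: power2_eq_square algebra_simps)
    ultimately have "(a-b)^2 \<le> 0" by simp
    then have "a = b" by simp
    then have "a*a = 1/4" using ab by simp
    then have "(a - 1/2)*(a + 1/2) = 0" by (simp add: algebra_simps)
    then have a: "a = 1/2" and b: "b = 1/2" using nn \<open>a = b\<close> by auto
    then have "a + b = 1" by simp
    note sec = sum_eq_1_sections[OF p q insert.hyps(2) U V insert.prems(5) this[unfolded a_def b_def]]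
    let ?w = "{l\<in>I. p l = 1/2 \<and> q l = 1/2}"
    have w: "{l\<in>insert j I. p l = 1/2 \<and> q l = 1/2}
      = (if p j = 1/2 \<and> q j = 1/2 then insert j ?w else ?w)" by auto
    have fw: "finite ?w" "j \<notin> ?w" using insert.hyps by auto
    have cw: "card ?w \<le> 2" "p j = 1/2 \<and> q j = 1/2 \<Longrightarrow> card ?w \<le> 1"
      using card_if_insert_le[OF fw insert.prems(7)[unfolded w]] by simp_all
    note aI = cube_measure_insert[OF insert.hyps U, of p, folded a_def, unfolded a]
      and bI = cube_measure_insert[OF insert.hyps V, of q, folded b_def, unfolded b]
    show ?case
    proof (cases "low j U = high j U \<and> low j V = high j V")
      case True
      then have "cube_measure I p (low j U) * cube_measure I q (low j V) = 1/4"
        using ab insert.hyps U V by (simp add: a_def b_def cube_measure_equal_sections)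
      then have "\<exists>l\<in>I. p l = 1/2 \<and> q l = 1/2 \<and> low j U = star I l \<and> low j V = star I l"
        using insert.IH[OF pI qI sU(1) sV(1) _ _ cw(1)] True sec(6) by simp
      then show ?thesis
        using True eq_starI(2)[OF insert.hyps(2)] by (metis insertI2)
    next
      case False
      then have pq: "p j = 1/2" "q j = 1/2" using sec(5) by auto
      from cross_inter_sum_eq_1[OF pI qI sU(1) sV(2) sec(6,3) cw(2)] pq
      consider "low j U = {}" | "high j V = {}" | l where "l \<in> I" "p l = 1/2" "low j U = star I l"
        by auto
      then show ?thesis
      proof cases
        case 1
        then have "cube_measure I p (high j U) = 1" "cube_measure I q (high j V) = 1"
          using aI sec(3) pq by simp_all
        moreover from this have "cube_measure I q (low j V) = 0" using sec(4) by simp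
        ultimately have "high j U = Pow I" "high j V = Pow I" "low j V = {}"
          using cube_measure_bounds(3,4)[OF pI half] cube_measure_bounds(3,4)[OF qI half] sU sV
          by blast+
        then show ?thesis using 1 pq eq_starI(1)[OF insert.hyps(2)] by blast
      next
        case 2
        then have "low j V = {}" using sec(2) by simp
        then show ?thesis using 2 bI by simp
      next
        case (3 l)
        have "cube_measure I p (low j U) + cube_measure I p (high j U) = 1"
          using aI pq by (simp add: field_simps)
        moreover have "cube_measure I p (low j U) = 1/2"
          using 3 cube_measure_star[OF insert.hyps(1)] by simp
        ultimately have "cube_measure I p (low j U) = cube_measure I p (high j U)" by linarith
        moreover from this have "cube_measure I q (low j V) = cube_measure I q (high j V)"
          using sec(3,4) by linarith
        ultimately have "low j U = high j U" "low j V = high j V"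
          using cube_measure_mono(2)[OF pI half sec(1) sU(2)] cube_measure_mono(2)[OF qI half sec(2) sV(2)]
          by blast+
        then show ?thesis using False by simp
      qed
    qed
  qed
qed

subsection \<open>A coordinate of probability above one half\<close>

lemma cross_inter_product_biased:
  assumes fin: "finite I" and j: "j \<notin> I"
    and p: "1/2 < p j" "p j < 1" "\<forall>l\<in>I. 0 < p l \<and> p l \<le> 1/2"
    and q: "0 < q j" "q j < 1" "\<forall>l\<in>I. 0 < q l \<and> q l \<le> 1/2 \<and> q l \<le> q j"
    and U: "U \<subseteq> Pow (insert j I)" and V: "V \<subseteq> Pow (insert j I)" and cross: "cross_inter U V"
  shows "cube_measure (insert j I) p U * cube_measure (insert j I) q V \<le> p j * q j \<and>
    (cube_measure (insert j I) p U * cube_measure (insert j I) q V = p j * q j \<longrightarrow>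
      U = star (insert j I) j \<and> V = star (insert j I) j)"
proof -
  define R where "R = min (q j) (1/2)"
  have R: "0 < R" "R \<le> 1/2" "R \<le> q j" using q by (auto simp: R_def)
  define p' q' where "p' = p(j := 1/2)" and "q' = q(j := R)"
  have pl: "prob_le (insert j I) p' (1/2)" and ql: "prob_le (insert j I) q' R"
    using fin j p q R by (auto simp: prob_le_def p'_def q'_def R_def)
  have pI: "prob_le I p (1/2)" and qI: "prob_le I q R"
    using fin p q by (auto simp: prob_le_def R_def)
  have lt: "(1/2::real) < 1" "R < 1" using R by auto
  note sU = low_subset[OF U] high_subset[OF U] and sV = low_subset[OF V] high_subset[OF V]
  define a0 a1 b0 b1 where "a0 = cube_measure I p (low j U)" and "a1 = cube_measure I p (high j U)"
    and "b0 = cube_measure I q (high j V)" and "b1 = cube_measure I q (low j V)"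
  define a b a' b' where "a = cube_measure (insert j I) p U" and "b = cube_measure (insert j I) q V"
    and "a' = cube_measure (insert j I) p' U" and "b' = cube_measure (insert j I) q' V"
  have same: "cube_measure I p' W = cube_measure I p W" "cube_measure I q' W = cube_measure I q W"
    if "W \<subseteq> Pow I" for W
    using that j by (auto intro!: cube_measure_cong simp: p'_def q'_def)
  have a: "a = (1 - p j)*a0 + p j*a1" and b: "b = (1 - q j)*b1 + q j*b0"
    unfolding a_def b_def a0_def a1_def b0_def b1_def using fin j U V by (simp_all add: cube_measure_insert)
  have a': "a' = (a0 + a1)/2" and b': "b' = (1-R)*b1 + R*b0"
    unfolding a'_def b'_def a0_def a1_def b0_def b1_def using fin j U V sU sV
    by (simp_all add: cube_measure_insert same) (simp_all add: p'_def q'_def)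
  have bd: "0 \<le> a0" "0 \<le> a1" "a1 \<le> 1" "0 \<le> b1" "b1 \<le> 1" "0 \<le> b0" "b0 \<le> 1"
    unfolding a0_def a1_def b0_def b1_def
    using cube_measure_bounds(1,2)[OF pI lt(1)] cube_measure_bounds(1,2)[OF qI lt(2)] sU sV by auto
  have nn: "0 \<le> a" "0 \<le> b" "0 \<le> b'" using a b b' bd p q R by auto
  have main: "a'*b' \<le> 1/2*R"
    using cross_inter_product[OF _ _ R(1,2) pl ql U V cross] by (simp add: a'_def b'_def)
  have "R*b \<le> q j*b'"
  proof -
    have "0 \<le> (q j - R)*b1" using R bd by simp
    also have "\<dots> = q j*b' - R*b" unfolding b b' by (simp add: algebra_simps)
    finally show ?thesis by simp
  qed
  then have "R*(a*b) \<le> a*(q j*b')" using nn mult_left_mono by (metis mult.left_commute)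
  also have "\<dots> = 2*p j*q j*(a'*b') - (2*p j - 1)*a0*(q j*b')"
    unfolding a a' by (simp add: field_simps)
  also have "\<dots> \<le> 2*p j*q j*(1/2*R) - (2*p j - 1)*a0*(q j*b')"
    using mult_left_mono[OF main, of "2*p j*q j"] p q by simp
  also have "\<dots> = R*(p j*q j) - (2*p j - 1)*a0*(q j*b')" by simp
  finally have bound: "R*(a*b) \<le> R*(p j*q j) - (2*p j - 1)*a0*(q j*b')" .
  have nn': "0 \<le> (2*p j - 1)*a0*(q j*b')" using p q bd nn by auto
  have le: "a*b \<le> p j*q j"
    using R(1) by (rule mult_left_le_imp_le[rotated]) (use bound nn' in linarith)
  have "U = star (insert j I) j \<and> V = star (insert j I) j" if eq: "a*b = p j*q j"
  proof -
    have "0 < a*b" using eq p q by simp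
    then have "0 < R*b" using R nn by (auto simp: zero_less_mult_iff)
    then have "0 < q j*b'" using \<open>R*b \<le> q j*b'\<close> by linarith
    moreover have "(2*p j - 1)*a0*(q j*b') = 0" using bound nn' eq by simp
    ultimately have a0: "a0 = 0" using p by auto
    then have lU: "low j U = {}" using cube_measure_bounds(3)[OF pI lt(1) sU(1)] by (simp add: a0_def)
    then have "cross_inter (high j U) (low j V)"
      using cross_inter_sections(2)[OF cross, of j] by simp
    from cross_inter_hoffman[OF _ _ R(1,2) pI qI sU(2) sV(1) this]
    have hof: "(1-R)*(a1*b1) \<le> R*((1-a1)*(1-b1))" by (simp add: a1_def b1_def)
    have dec: "(1 - q j)*(a1*b1) \<le> q j*((1-a1)*(1-b1))"
    proof (cases "q j \<le> 1/2")
      case True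
      then show ?thesis using hof by (simp add: R_def)
    next
      case False
      then have "a1*b1 \<le> (1-a1)*(1-b1)" using hof by (simp add: R_def)
      then show ?thesis using False bd q by (intro mult_mono[of "1 - q j" "q j" "a1*b1"]) auto
    qed
    have "a1*((1 - q j)*b1 + q j*b0) = q j"
      using eq p unfolding a b a0 by simp
    then have e: "(1 - q j)*(a1*b1) + q j*(a1*b0) = q j" by (simp add: algebra_simps)
    have "q j*(a1*b0) \<le> q j*(a1*1)" using bd q by (intro mult_left_mono) auto
    then have "q j \<le> q j*((1-a1)*(1-b1)) + q j*(a1*1)" using dec e by linarith
    also have "\<dots> = q j - q j*(b1*(1-a1))" by (simp add: algebra_simps)
    finally have "q j*(b1*(1-a1)) \<le> 0" by simp
    moreover have "0 \<le> b1*(1-a1)" using bd by simp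
    ultimately have "b1*(1-a1) = 0" using q bd by (auto simp: mult_le_0_iff)
    moreover have "b1 = 0" if "a1 = 1" using that dec q bd by (simp add: mult_le_0_iff)
    ultimately have b1: "b1 = 0" by auto
    then have "a1*b0 = 1" using e q by simp
    moreover have "a1*b0 \<le> a1" "a1*b0 \<le> b0" using bd by (simp_all add: mult_left_le mult_left_le_one_le)
    ultimately have "a1 = 1" "b0 = 1" using bd by auto
    then show ?thesis
      using lU b1 eq_starI(1)[OF j] cube_measure_bounds(3,4)[OF qI lt(2)]
        cube_measure_bounds(4)[OF pI lt(1)] sU sV
      unfolding a1_def b0_def b1_def by blast
  qed
  then show ?thesis using le unfolding a_def b_def by blast
qed

theorem theorem2:
  fixes n :: nat and p1v p2v :: "nat \<Rightarrow> real" and U1 U2 :: "nat set set"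
  assumes "n \<ge> 1"
    and "prob_vector n p1v" and "prob_vector n p2v"
    and "p1v 1 = Max (p1v ` {1..n})" and "p2v 1 = Max (p2v ` {1..n})"
    and "\<forall>l\<in>{2..n}. p1v l \<le> 1/2 \<and> p2v l \<le> 1/2"
    and "U1 \<subseteq> Pow {1..n}" and "U2 \<subseteq> Pow {1..n}"
    and "cross_intersecting U1 U2"
  shows "prod_measure n p1v U1 * prod_measure n p2v U2 \<le> p1v 1 * p2v 1
    \<and> (\<not> (p1v 1 = 1/2 \<and> p2v 1 = 1/2
              \<and> card {l \<in> {1..n}. p1v l = p1v 1 \<and> p2v l = p2v 1} \<ge> 3) \<longrightarrow>
         (prod_measure n p1v U1 * prod_measure n p2v U2 = p1v 1 * p2v 1 \<longleftrightarrow>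
          (\<exists>l\<in>{l \<in> {1..n}. p1v l = p1v 1 \<and> p2v l = p2v 1}.
              U1 = dictator n l \<and> U2 = dictator n l)))"
proof -
  define I where "I = {1..n}"
  define J where "J = {2..n}"
  have IJ: "I = insert 1 J" "1 \<notin> J" "finite J" and fin: "finite I"
    using assms(1) by (auto simp: I_def J_def)
  define P Q where "P = p1v 1" and "Q = p2v 1"
  have p: "0 < p1v l" "p1v l < 1" "p1v l \<le> P" and q: "0 < p2v l" "p2v l < 1" "p2v l \<le> Q"
    if "l \<in> I" for l
    using that assms(2-5) by (auto simp: prob_vector_def I_def P_def Q_def)
  have half: "p1v l \<le> 1/2" "p2v l \<le> 1/2" if "l \<in> J" for l
    using that assms(6) by (auto simp: J_def)
  have meas: "prod_measure n r W = cube_measure I r W" for r W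
    by (simp add: prod_measure_def prod_weight_def cube_measure_def I_def)
  have dict: "dictator n l = star I l" for l by (simp add: dictator_def star_def I_def)
  have cross: "cross_inter U1 U2" using assms(9) by (simp add: cross_intersecting_def cross_inter_def)
  have U: "U1 \<subseteq> Pow I" "U2 \<subseteq> Pow I" using assms(7,8) by (auto simp: I_def)
  have one: "1 \<in> I" using IJ by simp
  let ?m = "cube_measure I p1v U1 * cube_measure I p2v U2"
  let ?exc = "P = 1/2 \<and> Q = 1/2 \<and> card {l \<in> I. p1v l = P \<and> p2v l = Q} \<ge> 3"
  let ?dict = "\<exists>l\<in>I. p1v l = P \<and> p2v l = Q \<and> U1 = star I l \<and> U2 = star I l"
  have main: "?m \<le> P*Q \<and> (?m = P*Q \<longrightarrow> ?exc \<or> ?dict)"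
  proof -
    consider "P \<le> 1/2" "Q \<le> 1/2" | "1/2 < P" | "1/2 < Q" by linarith
    then show ?thesis
    proof cases
      case 1
      have PQ: "0 < P" "0 < Q" using p(1)[OF one] q(1)[OF one] by (auto simp: P_def Q_def)
      have pl: "prob_le I p1v P" and ql: "prob_le I p2v Q" using p q fin by (auto simp: prob_le_def)
      note m = cross_inter_product[OF PQ(1) 1(1) PQ(2) 1(2) pl ql U cross]
      show ?thesis
      proof (cases "P = 1/2 \<and> Q = 1/2")
        case True
        then have e: "P = 1/2" "Q = 1/2" by auto
        have ?dict if "?m = P*Q" "\<not> ?exc"
          unfolding e
        proof (rule cross_inter_product_half[OF pl[unfolded e] ql[unfolded e] U cross])
          show "?m = 1/4" using that(1) e by simp
          show "card {l\<in>I. p1v l = 1/2 \<and> p2v l = 1/2} \<le> 2" using that(2) unfolding e by simp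
        qed
        then show ?thesis using m by blast
      next
        case False
        then show ?thesis using m by blast
      qed
    next
      case 2
      have "?m \<le> P*Q \<and> (?m = P*Q \<longrightarrow> U1 = star I 1 \<and> U2 = star I 1)"
        unfolding IJ(1) P_def Q_def
        by (rule cross_inter_product_biased)
          (use 2 IJ p q half U cross in \<open>auto simp: P_def Q_def\<close>)
      then show ?thesis using one by (auto simp: P_def Q_def)
    next
      case 3
      have "cube_measure I p2v U2 * cube_measure I p1v U1 \<le> Q*P \<and>
        (cube_measure I p2v U2 * cube_measure I p1v U1 = Q*P \<longrightarrow> U2 = star I 1 \<and> U1 = star I 1)"
        unfolding IJ(1) P_def Q_def
        by (rule cross_inter_product_biased)
          (use 3 IJ p q half U cross cross_inter_commute[of U1] in \<open>auto simp: P_def Q_def\<close>)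
      then show ?thesis using one by (auto simp: P_def Q_def mult.commute)
    qed
  qed
  moreover have "?m = P*Q" if ?dict using that fin by (auto simp: cube_measure_star)
  ultimately have "?m \<le> P*Q \<and> (\<not> ?exc \<longrightarrow> (?m = P*Q \<longleftrightarrow> ?dict))" by blast
  then show ?thesis unfolding meas dict I_def[symmetric] P_def[symmetric] Q_def[symmetric] by auto
qed

end
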